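(* Let $n,w\ge1$ with $\gcd(n,w)=1$. Let $X$ be the set of all binary words of length $2n$ with exactly $n$ ones (equivalently, all north-east lattice paths from $(0,0)$ to $(n,n)$, $0$ = east step, $1$ = north step), and let $Y=\mathrm{AVL}(n,w)\subseteq X$ be the set of those paths that never visit a lattice point on the lines $y=x+w$ or $y=x-w$. Let $\beta$ act on $X$ by cyclically shifting the binary word two positions, $(b_1,\dots,b_{2n})\mapsto(b_{2n-1},b_{2n},b_1,\dots,b_{2n-2})$, generating a cyclic group $\langle\beta\rangle$ of order $n$. Let $f(q)=\sum_{\mathbf b\in Y}q^{\mathrm{maj}(\mathbf b)}$. Then for every $k\in\{1,\dots,n\}$, \[ f(\omega_n^k)=|\{y\in Y:\beta^k\cdot y=y\}|,\qquad \omega_n=e^{2\pi i/n}, \] i.e. $(Y\subset X,\langle\beta\rangle,f(q))$ is a subset cyclic sieving phenomenon.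
   Context: $\mathrm{maj}(\mathbf b)=\sum\{i: b_i>b_{i+1}\}$. Note that $Y$ need not be closed under $\beta$; the condition concerns fixed points of $\beta^k$ lying in $Y$. *)

theory Defs
  imports "HOL-Analysis.Analysis" "HOL-Computational_Algebra.Polynomial"
begin

text \<open>
  Words are \<open>0\<close>-indexed as lists: the letter \<open>b\<^sub>i\<close> of a word \<open>b\<^sub>1 \<dots> b\<^sub>m\<close> is \<open>b ! (i - 1)\<close>.
\<close>

definition balanced_words :: "nat \<Rightarrow> nat list set" where
  "balanced_words n = {b. length b = 2 * n \<and> set b \<subseteq> {0, 1} \<and> count_list b 1 = n}"

definition maj :: "nat list \<Rightarrow> nat" where
  "maj b = \<Sum> {i \<in> {1..<length b}. b ! (i - 1) > b ! i}"

text \<open>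
  The lattice points \<open>(x, y)\<close> visited by the path starting at the origin whose steps are the
  letters of \<open>b\<close>, where \<open>0\<close> is an east step and \<open>1\<close> is a north step.
\<close>

definition visited :: "nat list \<Rightarrow> (int \<times> int) set" where
  "visited b = {(int (count_list (take j b) 0), int (count_list (take j b) 1)) | j. j \<le> length b}"

definition AVL :: "nat \<Rightarrow> nat \<Rightarrow> nat list set" where
  "AVL n w = {b \<in> balanced_words n. \<forall>(x, y) \<in> visited b. y \<noteq> x + int w \<and> y \<noteq> x - int w}"

definition shift2 :: "nat list \<Rightarrow> nat list" where
  "shift2 b = drop (length b - 2) b @ take (length b - 2) b"

definition maj_poly :: "nat list set \<Rightarrow> nat poly" where
  "maj_poly Y = (\<Sum>b\<in>Y. monom 1 (maj b))"

text \<open>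
  Subset cyclic sieving for a subset \<open>Y\<close> of \<open>X\<close>, the cyclic group generated by a permutation
  \<open>g\<close> of \<open>X\<close>, and \<open>f\<close> a polynomial with coefficients in \<open>\<nat>\<close>. The fourth conjunct
  says that this group has order \<open>n\<close>. The set \<open>Y\<close> need not be closed under \<open>g\<close>.
\<close>

definition subset_csp :: "'a set \<Rightarrow> 'a set \<Rightarrow> ('a \<Rightarrow> 'a) \<Rightarrow> nat \<Rightarrow> nat poly \<Rightarrow> bool" where
  "subset_csp X Y g n f \<longleftrightarrow>
     finite X \<and> Y \<subseteq> X \<and> bij_betw g X X \<and>
     (\<forall>k. (\<forall>x\<in>X. (g ^^ k) x = x) \<longleftrightarrow> n dvd k) \<and>
     (\<forall>k\<in>{1..n}. poly (map_poly of_nat f) (exp (2 * of_real pi * \<i> / of_nat n) ^ k)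
        = of_nat (card {y \<in> Y. (g ^^ k) y = y}))"

end

theory Submission
  imports Defs "HOL-Number_Theory.Cong"
begin

text \<open>
  Let \<open>T(N, x)\<close> be the generating function by major index of the words of length \<open>N\<close> with \<open>x\<close>
  zeros whose paths avoid both lines. Splitting off the last letter gives
  \<open>T(N + 2, x) = T(N + 1, x) + T(N + 1, x - 1) + (q\<^sup>N\<^sup>+\<^sup>1 - 1) T(N, x - 1)\<close> strictly between
  the lines, if \<open>T\<close> is continued to the lines by \<open>T = 0\<close> on \<open>y = x - w\<close> and
  by \<open>T(N, x) = (1 - q\<^sup>N) T(N - 1, x)\<close> on \<open>y = x + w\<close>. Every translate in \<open>x\<close> of a Gaussian binomial
  coefficient solves the recurrence, so the reflection principle produces the solution
  \<open>\<Sum>\<^sub>k (-1)\<^sup>k q\<^bsup>w k (k + 1) / 2\<^esup> [N, x + k w]\<^sub>q\<close>.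

  At a primitive \<open>d\<close>-th root of unity with \<open>n = d m\<close>, the \<open>q\<close>-Lucas theorem kills all terms with
  \<open>d\<close> not dividing \<open>k\<close> (here \<open>gcd n w = 1\<close> enters), and what is left is the same sum for \<open>(m, w)\<close> at
  \<open>q = 1\<close>, that is \<open>card (AVL m w)\<close>. On the other side, the words fixed by a power of the shift are the
  \<open>d\<close>-fold repetitions of words in \<open>AVL m w\<close>, because a balanced path returns to the diagonal.
\<close>

section \<open>Gaussian binomial coefficients with integer lower index\<close>

text \<open>Pascal's rule instead of a quotient of q-factorials, so that \<open>q\<close> may be a
  root of unity. For \<open>j > Suc N\<close> the exponent is negative, but the coefficient next to
  it is zero.\<close>

primrec gauss_binomial :: "'a::field \<Rightarrow> nat \<Rightarrow> int \<Rightarrow> 'a" where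
  "gauss_binomial q 0 j = (if j = 0 then 1 else 0)"
| "gauss_binomial q (Suc N) j =
     gauss_binomial q N j + q powi (int (Suc N) - j) * gauss_binomial q N (j - 1)"

lemma gauss_binomial_eq_0: "j < 0 \<or> int N < j \<Longrightarrow> gauss_binomial q N j = 0"
  by (induction N arbitrary: j) auto

lemma gauss_binomial_0 [simp]: "gauss_binomial q N 0 = 1"
  by (induction N) (auto simp: gauss_binomial_eq_0)

text \<open>The dual Pascal rule: expand both terms of the defining rule by induction and
  regroup.\<close>

lemma gauss_binomial_Suc':
  assumes q: "q \<noteq> 0"
  shows "gauss_binomial q (Suc N) j = q powi j * gauss_binomial q N j + gauss_binomial q N (j - 1)"
proof (induction N arbitrary: j)
  case 0
  show ?case by auto
next
  case (Suc N)
  have e1: "q powi (int (Suc (Suc N)) - j) * q powi (j - 1) = q powi j * q powi (int (Suc N) - j)"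
    using q by (simp flip: power_int_add)
  have e2: "int (Suc N) - (j - 1) = int (Suc (Suc N)) - j"
    by simp
  have "gauss_binomial q (Suc (Suc N)) j
      = gauss_binomial q (Suc N) j + q powi (int (Suc (Suc N)) - j) * gauss_binomial q (Suc N) (j - 1)"
    by (rule gauss_binomial.simps)
  also have "\<dots> = q powi j * gauss_binomial q N j + gauss_binomial q N (j - 1)
      + q powi (int (Suc (Suc N)) - j) * q powi (j - 1) * gauss_binomial q N (j - 1)
      + q powi (int (Suc (Suc N)) - j) * gauss_binomial q N (j - 1 - 1)"
    unfolding Suc.IH by (simp add: algebra_simps)
  also have "\<dots> = q powi j * gauss_binomial q (Suc N) j + gauss_binomial q (Suc N) (j - 1)"
    unfolding e1 gauss_binomial.simps(2)[of q N] e2 by (simp add: algebra_simps)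
  finally show ?case .
qed

text \<open>Replacing \<open>j\<close> by \<open>Suc N - j\<close> exchanges the two Pascal
  rules.\<close>

lemma gauss_binomial_symmetric:
  assumes q: "q \<noteq> 0"
  shows "gauss_binomial q N (int N - j) = gauss_binomial q N j"
proof (induction N arbitrary: j)
  case (Suc N)
  have "gauss_binomial q (Suc N) (int (Suc N) - j)
      = gauss_binomial q N (int N - (j - 1)) + q powi j * gauss_binomial q N (int N - j)"
    by (simp add: algebra_simps)
  also have "\<dots> = gauss_binomial q (Suc N) j"
    unfolding Suc.IH gauss_binomial_Suc'[OF q] by simp
  finally show ?case .
qed simp

text \<open>Subtract \<open>q powi (Suc N - j)\<close> times the dual rule from the defining rule;
  the terms at \<open>j - 1\<close> cancel.\<close>

lemma gauss_binomial_absorb: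
  assumes q: "q \<noteq> 0"
  shows "(1 - q powi (int (Suc N) - j)) * gauss_binomial q (Suc N) j
    = (1 - q ^ Suc N) * gauss_binomial q N j"
proof -
  have e: "q powi (int (Suc N) - j) * q powi j = q ^ Suc N"
    using q by (simp flip: power_int_add power_int_of_nat)
  have "(1 - q powi (int (Suc N) - j)) * gauss_binomial q (Suc N) j
      = gauss_binomial q (Suc N) j - q powi (int (Suc N) - j) * gauss_binomial q (Suc N) j"
    by (simp only: left_diff_distrib mult_1)
  also have "\<dots> = gauss_binomial q N j - q powi (int (Suc N) - j) * q powi j * gauss_binomial q N j"
    by (subst gauss_binomial.simps(2), subst gauss_binomial_Suc'[OF q]) (simp add: algebra_simps)
  finally show ?thesis
    unfolding e by (simp add: algebra_simps)
qed

text \<open>Unlike Pascal's rule, this recurrence has coefficients that do not depend on \<open>j\<close>.\<close>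

lemma gauss_binomial_Suc_Suc:
  assumes q: "q \<noteq> 0"
  shows "gauss_binomial q (Suc (Suc N)) j = gauss_binomial q (Suc N) j
    + gauss_binomial q (Suc N) (j - 1) + (q ^ Suc N - 1) * gauss_binomial q N (j - 1)"
proof -
  define p where "p = q powi (int (Suc (Suc N)) - j)"
  have "int (Suc N) - (j - 1) = int (Suc (Suc N)) - j"
    by simp
  then have "(1 - p) * gauss_binomial q (Suc N) (j - 1) = (1 - q ^ Suc N) * gauss_binomial q N (j - 1)"
    using gauss_binomial_absorb[OF q, of N "j - 1"] by (simp only: p_def)
  moreover have "p * G = G + (Q - 1) * H" if "(1 - p) * G = (1 - Q) * H" for G Q H
    using that by (simp add: algebra_simps)
  ultimately show ?thesis
    unfolding gauss_binomial.simps(2)[of q "Suc N"] p_def[symmetric] by (simp only: add.assoc)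
qed

text \<open>In the absorption identity for row \<open>d\<close> the right side has the factor
  \<open>1 - q ^ d = 0\<close>, while \<open>1 - q ^ (d - j)\<close> is nonzero for
  \<open>0 < j < d\<close>.\<close>

lemma gauss_binomial_root_of_unity_base:
  assumes "d > 0" and qd: "q ^ d = 1" and prim: "\<And>i. 0 < i \<Longrightarrow> i < d \<Longrightarrow> q ^ i \<noteq> 1"
  shows "gauss_binomial q d j = (if j = 0 then 1 else 0) + (if j = int d then 1 else 0)"
proof -
  have q: "q \<noteq> 0"
    using \<open>d > 0\<close> qd by (auto simp: power_0_left)
  consider "j < 0 \<or> int d < j" | "j = 0" | "j = int d" | "0 < j" "j < int d"
    by linarith
  then show ?thesis
  proof cases
    case 1
    then show ?thesis by (auto simp: gauss_binomial_eq_0)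
  next
    case 2
    then show ?thesis using \<open>d > 0\<close> by simp
  next
    case 3
    then show ?thesis
      using \<open>d > 0\<close> gauss_binomial_symmetric[OF q, of d 0] by simp
  next
    case 4
    obtain N where N: "d = Suc N"
      using \<open>d > 0\<close> gr0_implies_Suc by blast
    have e: "q powi (int d - j) = q ^ nat (int d - j)"
      using 4 by (simp add: power_int_def)
    have "(1 - q powi (int d - j)) * gauss_binomial q d j = 0"
      using gauss_binomial_absorb[OF q, of N j] qd unfolding N by simp
    moreover have "q powi (int d - j) \<noteq> 1"
      unfolding e using 4 by (intro prim) auto
    ultimately show ?thesis
      using 4 by simp
  qed
qed

text \<open>Powers of \<open>q\<close> have period \<open>d\<close>, so Pascal's rule keeps its
  coefficients when \<open>N\<close> or \<open>j\<close> moves by \<open>d\<close>; the identity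
  propagates from row \<open>d\<close>.\<close>

lemma gauss_binomial_lucas_step:
  assumes "d > 0" and qd: "q ^ d = 1" and prim: "\<And>i. 0 < i \<Longrightarrow> i < d \<Longrightarrow> q ^ i \<noteq> 1"
  shows "gauss_binomial q (N + d) j = gauss_binomial q N j + gauss_binomial q N (j - int d)"
proof (induction N arbitrary: j)
  case 0
  show ?case
    using gauss_binomial_root_of_unity_base[OF assms, of j] by simp
next
  case (Suc N)
  have q: "q \<noteq> 0"
    using \<open>d > 0\<close> qd by (auto simp: power_0_left)
  have per: "q powi (e + int d) = q powi e" for e
    using q qd by (simp add: power_int_add)
  have e1: "q powi (int (Suc (N + d)) - j) = q powi (int (Suc N) - j)"
    using per[of "int (Suc N) - j"] by (simp add: algebra_simps)
  have e2: "q powi (int (Suc N) - (j - int d)) = q powi (int (Suc N) - j)"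
    using per[of "int (Suc N) - j"] by (simp add: algebra_simps)
  have e3: "j - 1 - int d = j - int d - 1" by simp
  show ?case
    unfolding add_Suc gauss_binomial.simps(2) e1 e2 Suc.IH e3 by (simp add: algebra_simps)
qed

text \<open>On multiples of \<open>d\<close>, the step by \<open>d\<close> is Pascal's rule at
  \<open>q = 1\<close>.\<close>

lemma gauss_binomial_lucas:
  assumes "d > 0" and qd: "q ^ d = 1" and prim: "\<And>i. 0 < i \<Longrightarrow> i < d \<Longrightarrow> q ^ i \<noteq> 1"
  shows "gauss_binomial q (d * m) j = (if int d dvd j then gauss_binomial 1 m (j div int d) else 0)"
proof (induction m arbitrary: j)
  case 0
  show ?case using \<open>d > 0\<close> by auto
next
  case (Suc m)
  have "gauss_binomial q (d * Suc m) j = gauss_binomial q (d * m) j + gauss_binomial q (d * m) (j - int d)"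
    using gauss_binomial_lucas_step[OF assms, of "d * m" j] by (simp add: add.commute)
  moreover have "int d dvd j - int d \<longleftrightarrow> int d dvd j"
    by (intro dvd_diff_left_iff) simp
  moreover have "(j - int d) div int d = j div int d - 1"
    using \<open>d > 0\<close> div_mult_self1[of "int d" j "-1"] by simp
  ultimately show ?case
    by (simp add: Suc.IH)
qed

section \<open>The reflection sum\<close>

text \<open>For nonzero \<open>q\<close>, the value 1 at \<open>k = 0\<close> and the two reflection
  rules below, for \<open>-1 - k\<close> and \<open>1 - k\<close>, force this weight. The division
  by 2 is exact.\<close>

definition reflection_weight :: "nat \<Rightarrow> 'a::field \<Rightarrow> int \<Rightarrow> 'a" where
  "reflection_weight w q k = (-1) powi k * q powi (int w * (k * (k + 1) div 2))"

text \<open>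
  \<open>M\<close> only truncates a sum over all integers: the results below assume \<open>M\<close> large enough for the
  omitted terms to vanish.
\<close>

definition reflection_sum :: "nat \<Rightarrow> nat \<Rightarrow> 'a::field \<Rightarrow> nat \<Rightarrow> int \<Rightarrow> 'a" where
  "reflection_sum M w q N x =
     (\<Sum>k = - int M..int M. reflection_weight w q k * gauss_binomial q N (x + k * int w))"

text \<open>The map to \<open>-1 - k\<close> preserves \<open>k * (k + 1)\<close> and flips parity.
  It is the reflection for the line \<open>y = x - w\<close>; \<open>1 - k\<close> below serves
  \<open>y = x + w\<close>.\<close>

lemma reflection_weight_below: "reflection_weight w q (- 1 - k) = - reflection_weight w q k"
proof -
  have "(-1 - k) * (-1 - k + 1) = k * (k + 1)" by (simp add: algebra_simps)
  then show ?thesis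
    unfolding reflection_weight_def by (simp add: power_int_minus_left)
qed

lemma reflection_weight_above:
  assumes "q \<noteq> 0"
  shows "reflection_weight w q (1 - k) = - reflection_weight w q k * q powi (int w * (1 - 2 * k))"
proof -
  have "(1 - k) * (1 - k + 1) = k * (k + 1) + (1 - 2 * k) * 2" by (simp add: algebra_simps)
  then have "(1 - k) * (1 - k + 1) div 2 = k * (k + 1) div 2 + (1 - 2 * k)"
    by simp
  then show ?thesis
    unfolding reflection_weight_def using assms
    by (simp add: power_int_minus_left distrib_left power_int_add)
qed

lemma sum_antisymmetric_eq_0:
  fixes f :: "int \<Rightarrow> 'a::field_char_0"
  assumes "\<And>k. f (a + b - k) = - f k"
  shows "(\<Sum>k = a..b. f k) = 0"
proof -
  have "(\<Sum>k = a..b. f k) = (\<Sum>k = a..b. f (a + b - k))"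
    by (rule sum.reindex_bij_witness[of _ "\<lambda>k. a + b - k" "\<lambda>k. a + b - k"]) auto
  then show ?thesis
    by (simp add: assms sum_negf)
qed

text \<open>The terms at \<open>k\<close> and \<open>-1 - k\<close> cancel: their lower indices add
  up to \<open>N\<close> on this line, and their weights are opposite.\<close>

lemma reflection_sum_lower_line:
  fixes q :: "'a::field_char_0"
  assumes q: "q \<noteq> 0" and "w > 0" and "N \<le> M" and line: "int N - 2 * x = - int w"
  shows "reflection_sum M w q N x = 0"
proof -
  define f where "f k = reflection_weight w q k * gauss_binomial q N (x + k * int w)" for k
  have "f (- int M - 1 + int M - k) = - f k" for k
  proof -
    have "x + (- 1 - k) * int w = int N - (x + k * int w)"
      using line by (simp add: algebra_simps)
    then have "gauss_binomial q N (x + (- 1 - k) * int w) = gauss_binomial q N (x + k * int w)"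
      by (simp only: gauss_binomial_symmetric[OF q])
    then show ?thesis
      by (simp add: f_def reflection_weight_below)
  qed
  \<comment> \<open>The range needs the extra index \<open>-M - 1\<close> to be stable under the
    reflection. Twice the lower index there is \<open>N - (2 * M + 1) * w\<close>, which is
    negative, so the term vanishes.\<close>
  then have "(\<Sum>k = - int M - 1..int M. f k) = 0"
    by (rule sum_antisymmetric_eq_0)
  moreover have "{- int M - 1..int M} = insert (- int M - 1) {- int M..int M}"
    by auto
  moreover have "f (- int M - 1) = 0"
  proof -
    have "(2 * int M + 1) * 1 \<le> (2 * int M + 1) * int w"
      using \<open>w > 0\<close> by (intro mult_left_mono) auto
    then have "x + (- int M - 1) * int w < 0"
      using line \<open>N \<le> M\<close> by (simp add: algebra_simps)
    then show ?thesis
      by (simp add: f_def gauss_binomial_eq_0)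
  qed
  ultimately have "(\<Sum>k = - int M..int M. f k) = 0"
    by simp
  then show ?thesis
    by (simp add: reflection_sum_def f_def)
qed

text \<open>
  On this line it is \<open>T(N, x) + (q\<^sup>N - 1) T(N - 1, x)\<close>, the contribution of the words that leave the
  line by a letter \<open>0\<close>, and not \<open>T(N, x)\<close> itself that has to vanish.
\<close>

lemma reflection_sum_upper_line:
  fixes q :: "'a::field_char_0"
  assumes q: "q \<noteq> 0" and "w > 0" and "Suc N \<le> M" and line: "int (Suc N) - 2 * x = int w"
  shows "reflection_sum M w q (Suc N) x = (1 - q ^ Suc N) * reflection_sum M w q N x"
proof -
  \<comment> \<open>By absorption, \<open>f k\<close> is the \<open>k\<close>-th term of the
    difference of the two sides. Its extra power of \<open>q\<close> compensates the factor that the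
    weight picks up under \<open>1 - k\<close>.\<close>
  define f where "f k = reflection_weight w q k * q powi (int (Suc N) - (x + k * int w))
    * gauss_binomial q (Suc N) (x + k * int w)" for k
  have "f (- int M + (int M + 1) - k) = - f k" for k
  proof -
    have e: "x + (1 - k) * int w = int (Suc N) - (x + k * int w)"
      using line by (simp add: algebra_simps)
    have "int w * (1 - 2 * k) + (int (Suc N) - (x + (1 - k) * int w)) = int (Suc N) - (x + k * int w)"
      using line by (simp add: algebra_simps)
    then have "q powi (int w * (1 - 2 * k)) * q powi (int (Suc N) - (x + (1 - k) * int w))
        = q powi (int (Suc N) - (x + k * int w))"
      using power_int_add[of q "int w * (1 - 2 * k)" "int (Suc N) - (x + (1 - k) * int w)"] q
      by (simp only: simp_thms)
    then have "f (1 - k) = - reflection_weight w q k * q powi (int (Suc N) - (x + k * int w))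
      * gauss_binomial q (Suc N) (x + (1 - k) * int w)"
      unfolding f_def reflection_weight_above[OF q] by (simp only: mult.assoc)
    then show ?thesis
      unfolding e gauss_binomial_symmetric[OF q] by (simp add: f_def)
  qed
  \<comment> \<open>Here the extra index is \<open>M + 1\<close>; twice its lower index is
    \<open>Suc N + (2 * M + 1) * w\<close>, more than \<open>2 * Suc N\<close>.\<close>
  then have "(\<Sum>k = - int M..int M + 1. f k) = 0"
    by (rule sum_antisymmetric_eq_0)
  moreover have "{- int M..int M + 1} = insert (int M + 1) {- int M..int M}"
    by auto
  moreover have "f (int M + 1) = 0"
  proof -
    have "(2 * int M + 1) * 1 \<le> (2 * int M + 1) * int w"
      using \<open>w > 0\<close> by (intro mult_left_mono) auto
    then have "int (Suc N) < x + (int M + 1) * int w"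
      using line \<open>Suc N \<le> M\<close> by (simp add: algebra_simps)
    then show ?thesis
      unfolding f_def by (subst gauss_binomial_eq_0) auto
  qed
  ultimately have "(\<Sum>k = - int M..int M. f k) = 0"
    by simp
  moreover have "f k = reflection_weight w q k * gauss_binomial q (Suc N) (x + k * int w)
      - (1 - q ^ Suc N) * (reflection_weight w q k * gauss_binomial q N (x + k * int w))" for k
  proof -
    define g where "g = gauss_binomial q (Suc N) (x + k * int w)"
    define p where "p = q powi (int (Suc N) - (x + k * int w))"
    have "(1 - p) * g = (1 - q ^ Suc N) * gauss_binomial q N (x + k * int w)"
      unfolding g_def p_def by (rule gauss_binomial_absorb[OF q])
    then have "p * g = g - (1 - q ^ Suc N) * gauss_binomial q N (x + k * int w)"
      by (simp only: left_diff_distrib mult_1) (simp add: algebra_simps)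
    then have "reflection_weight w q k * (p * g)
        = reflection_weight w q k * (g - (1 - q ^ Suc N) * gauss_binomial q N (x + k * int w))"
      by simp
    then show ?thesis
      unfolding f_def g_def[symmetric] p_def[symmetric]
      by (simp only: right_diff_distrib mult_ac)
  qed
  ultimately show ?thesis
    unfolding reflection_sum_def by (simp only: sum_subtractf sum_distrib_left) simp
qed

text \<open>A nonzero \<open>k\<close> would move \<open>x\<close> by at least \<open>w\<close>. The
  bound is not strict because both \<open>x\<close> and \<open>x - 1\<close> must satisfy it at
  length 1.\<close>

lemma reflection_sum_0:
  assumes "w > 0" and x: "\<bar>2 * x\<bar> \<le> int w"
  shows "reflection_sum M w q 0 x = (if x = 0 then 1 else 0)"
proof -
  have "x + k * int w = 0 \<longleftrightarrow> k = 0 \<and> x = 0" for k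
  proof
    assume h: "x + k * int w = 0"
    have "k = 0"
    proof (rule ccontr)
      assume "k \<noteq> 0"
      then have "1 * int w \<le> \<bar>k\<bar> * int w"
        by (intro mult_right_mono) auto
      moreover have "\<bar>k\<bar> * int w = \<bar>x\<bar>"
      proof -
        have "k * int w = - x" using h by linarith
        then have "\<bar>k * int w\<bar> = \<bar>x\<bar>" by simp
        then show ?thesis by (simp add: abs_mult)
      qed
      ultimately show False
        using x \<open>w > 0\<close> by linarith
    qed
    with h show "k = 0 \<and> x = 0" by simp
  qed simp
  then have "reflection_sum M w q 0 x
      = (\<Sum>k = - int M..int M. if k = 0 then (if x = 0 then 1 else 0) else 0)"
    unfolding reflection_sum_def by (intro sum.cong) (auto simp: reflection_weight_def)
  then show ?thesis
    by simp
qed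

text \<open>The second initial value: in row 0 the coefficient at \<open>j - 1\<close> is nonzero
  only for \<open>j = 1\<close>, where the power of \<open>q\<close> is 1.\<close>

lemma reflection_sum_1:
  "reflection_sum M w q (Suc 0) x = reflection_sum M w q 0 x + reflection_sum M w q 0 (x - 1)"
proof -
  have "gauss_binomial q (Suc 0) j = gauss_binomial q 0 j + gauss_binomial q 0 (j - 1)" for j
    by auto
  then show ?thesis
    unfolding reflection_sum_def
    by (simp only: distrib_left sum.distrib) (simp add: algebra_simps)
qed

lemma reflection_sum_Suc_Suc:
  assumes q: "q \<noteq> 0"
  shows "reflection_sum M w q (Suc (Suc N)) x = reflection_sum M w q (Suc N) x
    + reflection_sum M w q (Suc N) (x - 1) + (q ^ Suc N - 1) * reflection_sum M w q N (x - 1)"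
proof -
  have e: "x + k * int w - 1 = x - 1 + k * int w" for k by simp
  show ?thesis
    unfolding reflection_sum_def gauss_binomial_Suc_Suc[OF q] sum_distrib_left sum.distrib[symmetric] e
    by (intro sum.cong refl) (simp only: distrib_left mult_ac)
qed

section \<open>Words avoiding two lines, weighted by the major index\<close>

text \<open>The value of \<open>y - x\<close> at the endpoint, so that the forbidden lines are the
  heights \<open>w\<close> and \<open>-w\<close>.\<close>

definition height :: "nat list \<Rightarrow> int" where
  "height b = int (count_list b 1) - int (count_list b 0)"

definition avoids :: "nat \<Rightarrow> nat list \<Rightarrow> bool" where
  "avoids w b \<longleftrightarrow> (\<forall>j\<le>length b. \<bar>height (take j b)\<bar> \<noteq> int w)"

definition walks :: "nat \<Rightarrow> nat \<Rightarrow> int \<Rightarrow> nat list set" where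
  "walks w N x =
     {b. length b = N \<and> set b \<subseteq> {0, 1} \<and> int (count_list b 0) = x \<and> avoids w b}"

lemma height_append: "height (u @ v) = height u + height v"
  by (simp add: height_def)

lemma avoids_append:
  "avoids w (u @ v) \<longleftrightarrow> avoids w u \<and> (\<forall>j\<le>length v. \<bar>height u + height (take j v)\<bar> \<noteq> int w)"
proof
  assume h: "avoids w (u @ v)"
  have "\<bar>height (take j u)\<bar> \<noteq> int w" if "j \<le> length u" for j
    using h[unfolded avoids_def, rule_format, of j] that by simp
  moreover have "\<bar>height u + height (take j v)\<bar> \<noteq> int w" if "j \<le> length v" for j
    using h[unfolded avoids_def, rule_format, of "length u + j"] that by (simp add: height_append)
  ultimately show "avoids w u \<and> (\<forall>j\<le>length v. \<bar>height u + height (take j v)\<bar> \<noteq> int w)"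
    by (simp add: avoids_def)
next
  assume h: "avoids w u \<and> (\<forall>j\<le>length v. \<bar>height u + height (take j v)\<bar> \<noteq> int w)"
  show "avoids w (u @ v)"
    unfolding avoids_def
  proof (intro allI impI)
    fix j assume j: "j \<le> length (u @ v)"
    show "\<bar>height (take j (u @ v))\<bar> \<noteq> int w"
    proof (cases "j \<le> length u")
      case True
      with h show ?thesis by (simp add: avoids_def)
    next
      case False
      with h j show ?thesis by (simp add: height_append)
    qed
  qed
qed

lemma avoids_snoc: "avoids w (b @ [l]) \<longleftrightarrow> avoids w b \<and> \<bar>height (b @ [l])\<bar> \<noteq> int w"
proof -
  have "\<bar>height b\<bar> \<noteq> int w" if "avoids w b"
    using that[unfolded avoids_def, rule_format, of "length b"] by simp
  then show ?thesis
    by (auto simp: avoids_append height_append le_Suc_eq height_def)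
qed

lemma length_binary:
  "set b \<subseteq> {0, 1} \<Longrightarrow> length b = count_list b 0 + count_list b (1::nat)"
  by (induction b) auto

lemma height_walks: "b \<in> walks w N x \<Longrightarrow> height b = int N - 2 * x"
  using length_binary[of b] by (auto simp: walks_def height_def)

lemma finite_walks: "finite (walks w N x)"
  by (rule finite_subset[OF _ finite_lists_length_eq[of "{0, 1}" N]]) (auto simp: walks_def)

lemma walks_on_line: "\<bar>int N - 2 * x\<bar> = int w \<Longrightarrow> walks w N x = {}"
proof -
  assume line: "\<bar>int N - 2 * x\<bar> = int w"
  have False if b: "b \<in> walks w N x" for b
  proof -
    have "avoids w b" "length b = N"
      using b by (simp_all add: walks_def)
    then have "\<bar>height b\<bar> \<noteq> int w"
      by (auto simp: avoids_def dest: spec[of _ N])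
    with height_walks[OF b] line show False by simp
  qed
  then show ?thesis by blast
qed

lemma walks_0: "w > 0 \<Longrightarrow> walks w 0 x = (if x = 0 then {[]} else {})"
  by (auto simp: walks_def avoids_def height_def)

text \<open>The assumption \<open>off\<close> keeps the new endpoint off the lines, so every
  extension of a shorter walk is allowed.\<close>

lemma walks_Suc:
  assumes off: "\<bar>int (Suc N) - 2 * x\<bar> \<noteq> int w"
  shows "walks w (Suc N) x = (\<lambda>b. b @ [1]) ` walks w N x \<union> (\<lambda>b. b @ [0]) ` walks w N (x - 1)"
    (is "_ = ?R")
proof
  show "walks w (Suc N) x \<subseteq> ?R"
  proof
    fix b assume b: "b \<in> walks w (Suc N) x"
    then have "length b = Suc N"
      by (simp add: walks_def)
    then obtain c l where c: "b = c @ [l]"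
      by (auto simp: length_Suc_conv_rev)
    from b c have "l = 0 \<or> l = 1"
      by (auto simp: walks_def)
    then show "b \<in> ?R"
      using b c by (auto simp: walks_def avoids_snoc)
  qed
  show "?R \<subseteq> walks w (Suc N) x"
  proof
    fix b assume "b \<in> ?R"
    then consider c where "b = c @ [1]" "c \<in> walks w N x"
      | c where "b = c @ [0]" "c \<in> walks w N (x - 1)"
      by auto
    then show "b \<in> walks w (Suc N) x"
    proof cases
      case 1
      have "height b = int (Suc N) - 2 * x"
        using height_walks[OF 1(2)] 1(1) by (simp add: height_append) (simp add: height_def)
      with 1 off show ?thesis by (auto simp: walks_def avoids_snoc)
    next
      case 2
      have "height b = int (Suc N) - 2 * x"
        using height_walks[OF 2(2)] 2(1) by (simp add: height_append) (simp add: height_def)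
      with 2 off show ?thesis by (auto simp: walks_def avoids_snoc)
    qed
  qed
qed

text \<open>The only possible new descent is at position \<open>length b\<close>, which is also its
  contribution.\<close>

lemma maj_snoc: "maj (b @ [l]) = maj b + (if b \<noteq> [] \<and> l < last b then length b else 0)"
proof (cases "b = []")
  case True
  then show ?thesis by (simp add: maj_def)
next
  case False
  have "{i \<in> {1..<length (b @ [l])}. (b @ [l]) ! (i - 1) > (b @ [l]) ! i}
    = {i \<in> {1..<length b}. b ! (i - 1) > b ! i} \<union> (if l < last b then {length b} else {})"
    using False by (auto simp: nth_append last_conv_nth less_Suc_eq split: if_splits)
  then show ?thesis
    using False by (simp add: maj_def)
qed

section \<open>Generating functions by major index\<close>

definition walk_gf :: "nat \<Rightarrow> 'a::field \<Rightarrow> nat \<Rightarrow> int \<Rightarrow> 'a" where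
  "walk_gf w q N x = (\<Sum>b\<in>walks w N x. q ^ maj b)"

text \<open>The contribution of \<open>b\<close> once an east step is appended; only
  \<open>b\<close> itself has to avoid the lines.\<close>

definition walk_gf0 :: "nat \<Rightarrow> 'a::field \<Rightarrow> nat \<Rightarrow> int \<Rightarrow> 'a" where
  "walk_gf0 w q N x = (\<Sum>b\<in>walks w N x. q ^ maj (b @ [0]))"

lemma walk_gf_on_line: "\<bar>int N - 2 * x\<bar> = int w \<Longrightarrow> walk_gf w q N x = 0"
  "\<bar>int N - 2 * x\<bar> = int w \<Longrightarrow> walk_gf0 w q N x = 0"
  by (simp_all add: walk_gf_def walk_gf0_def walks_on_line)

lemma sum_walks_Suc:
  assumes "\<bar>int (Suc N) - 2 * x\<bar> \<noteq> int w"
  shows "(\<Sum>b\<in>walks w (Suc N) x. F b)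
    = (\<Sum>b\<in>walks w N x. F (b @ [1])) + (\<Sum>b\<in>walks w N (x - 1). F (b @ [0]))"
  unfolding walks_Suc[OF assms]
  by (subst sum.union_disjoint) (auto simp: finite_walks sum.reindex inj_on_def)

lemma walk_gf_0:
  assumes "w > 0"
  shows "walk_gf w q 0 x = (if x = 0 then 1 else 0)" "walk_gf0 w q 0 x = walk_gf w q 0 x"
  using assms maj_snoc[of "[]" 0] by (simp_all add: walk_gf_def walk_gf0_def walks_0 maj_def[of "[]"])

lemma last_walk: "b \<in> walks w N x \<Longrightarrow> b \<noteq> [] \<Longrightarrow> last b \<le> 1"
proof -
  assume "b \<in> walks w N x" "b \<noteq> []"
  then have "last b \<in> {0, 1}"
    using last_in_set[of b] unfolding walks_def by blast
  then show ?thesis by auto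
qed

lemma walk_gf_Suc:
  assumes "\<bar>int (Suc N) - 2 * x\<bar> \<noteq> int w"
  shows "walk_gf w q (Suc N) x = walk_gf w q N x + walk_gf0 w q N (x - 1)"
proof -
  have "maj (b @ [1]) = maj b" if "b \<in> walks w N x" for b
    using last_walk[OF that] by (auto simp: maj_snoc)
  then show ?thesis
    unfolding walk_gf_def walk_gf0_def sum_walks_Suc[OF assms] by simp
qed

text \<open>A further 0 creates a descent at \<open>Suc N\<close> exactly after a final 1. Compare
  with the same split of \<open>walk_gf\<close>, where words ending in 1 lack the factor
  \<open>q ^ Suc N\<close>.\<close>

lemma walk_gf0_Suc:
  assumes "\<bar>int (Suc N) - 2 * x\<bar> \<noteq> int w"
  shows "walk_gf0 w q (Suc N) x = walk_gf w q (Suc N) x + (q ^ Suc N - 1) * walk_gf w q N x"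
proof -
  have "q ^ maj ((b @ [1]) @ [0]) = q ^ Suc N * q ^ maj b" if "b \<in> walks w N x" for b
  proof -
    have "maj ((b @ [1]) @ [0]) = maj b + Suc N"
      unfolding maj_snoc[of "b @ [1]"] using last_walk[OF that] that
      by (auto simp: maj_snoc[of b] walks_def)
    then show ?thesis by (simp add: power_add)
  qed
  moreover have "maj ((b @ [0]) @ [0]) = maj (b @ [0])" for b
    by (simp only: maj_snoc[of "b @ [0]"]) simp
  ultimately have "walk_gf0 w q (Suc N) x = q ^ Suc N * walk_gf w q N x + walk_gf0 w q N (x - 1)"
    unfolding walk_gf_def walk_gf0_def sum_walks_Suc[OF assms] sum_distrib_left
    by (intro arg_cong2[of _ _ _ _ "(+)"] sum.cong) auto
  then show ?thesis
    unfolding walk_gf_Suc[OF assms] by (simp only: left_diff_distrib mult_1) simp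
qed

text \<open>Both sides satisfy the same two-step recurrence strictly between the lines; the two line
  lemmas supply the boundary values.\<close>

lemma walk_gf_eq_reflection_sum:
  fixes q :: "'a::field_char_0"
  assumes q: "q \<noteq> 0" and w: "w > 0"
  shows "N \<le> M \<Longrightarrow> \<bar>int N - 2 * x\<bar> < int w \<Longrightarrow> walk_gf w q N x = reflection_sum M w q N x"
proof (induction N arbitrary: x rule: less_induct)
  case (less N)
  consider "N = 0" | "N = Suc 0" | K where "N = Suc (Suc K)"
    by (metis not0_implies_Suc)
  then show ?case
  proof cases
    case 1
    with less.prems w show ?thesis
      by (simp add: walk_gf_0 reflection_sum_0)
  next
    case 2
    have "walk_gf w q N x = walk_gf w q 0 x + walk_gf w q 0 (x - 1)"
      using less.prems w unfolding 2 by (subst walk_gf_Suc) (auto simp: walk_gf_0)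
    moreover have "\<bar>2 * x\<bar> \<le> int w" "\<bar>2 * (x - 1)\<bar> \<le> int w"
      using less.prems 2 by auto
    ultimately show ?thesis
      using w unfolding 2 reflection_sum_1 by (simp add: walk_gf_0 reflection_sum_0)
  next
    case (3 K)
    \<comment> \<open>Before a final north step the height is one less, so only the line at
      \<open>-w\<close> can be hit.\<close>
    have lower: "walk_gf w q (Suc K) x = reflection_sum M w q (Suc K) x"
    proof (cases "int (Suc K) - 2 * x = - int w")
      case True
      then show ?thesis
        using less.prems 3 walk_gf_on_line(1)[of "Suc K" x w q]
          reflection_sum_lower_line[OF q w _ True, of M] by simp
    next
      case False
      then show ?thesis
        using less.prems 3 by (intro less.IH) auto
    qed
    \<comment> \<open>Before a final east step the height is one more, so only the line at
      \<open>w\<close> can be hit. The walks of length \<open>K\<close> have the original height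
      again and fall under the induction hypothesis.\<close>
    have upper: "walk_gf0 w q (Suc K) (x - 1) = reflection_sum M w q (Suc K) (x - 1)
      + (q ^ Suc K - 1) * reflection_sum M w q K (x - 1)"
    proof (cases "int (Suc K) - 2 * (x - 1) = int w")
      case True
      then show ?thesis
        using less.prems 3 walk_gf_on_line(2)[of "Suc K" "x - 1" w q]
          reflection_sum_upper_line[OF q w _ True, of M] by (simp add: algebra_simps)
    next
      case False
      have "walk_gf w q (Suc K) (x - 1) = reflection_sum M w q (Suc K) (x - 1)"
        "walk_gf w q K (x - 1) = reflection_sum M w q K (x - 1)"
        using less.prems 3 False by (auto intro!: less.IH)
      moreover have "\<bar>int (Suc K) - 2 * (x - 1)\<bar> \<noteq> int w"
        using less.prems 3 False by auto
      ultimately show ?thesis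
        by (subst walk_gf0_Suc) simp_all
    qed
    have "\<bar>int (Suc (Suc K)) - 2 * x\<bar> \<noteq> int w"
      using less.prems 3 by auto
    then show ?thesis
      unfolding 3 reflection_sum_Suc_Suc[OF q] by (subst walk_gf_Suc) (simp_all add: lower upper)
  qed
qed

lemma walk_gf_1: "walk_gf w 1 N x = of_nat (card (walks w N x))"
  by (simp add: walk_gf_def)

lemma AVL_eq_walks: "AVL n w = walks w (2 * n) (int n)"
proof -
  have "b \<in> balanced_words n \<longleftrightarrow> length b = 2 * n \<and> set b \<subseteq> {0, 1} \<and> int (count_list b 0) = int n" for b
    using length_binary[of b] by (auto simp: balanced_words_def)
  moreover have "(\<forall>(x, y) \<in> visited b. y \<noteq> x + int w \<and> y \<noteq> x - int w) \<longleftrightarrow> avoids w b" for b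
    unfolding visited_def avoids_def height_def by fastforce
  ultimately show ?thesis
    by (auto simp: AVL_def walks_def)
qed

lemma poly_maj_poly:
  fixes z :: "'a::{comm_ring_1,semiring_char_0}"
  assumes "finite Y"
  shows "poly (map_poly of_nat (maj_poly Y)) z = (\<Sum>b\<in>Y. z ^ maj b)"
  using assms
proof (induction Y rule: finite_induct)
  case empty
  show ?case by (simp add: maj_poly_def)
next
  case (insert b Y)
  have "map_poly of_nat (monom 1 (maj b) + p) = monom 1 (maj b) + (map_poly of_nat p :: 'a poly)" for p
    by (intro poly_eqI) (auto simp: coeff_map_poly)
  then show ?case
    using insert by (simp add: maj_poly_def poly_monom)
qed

section \<open>Evaluation at roots of unity\<close>

text \<open>For odd \<open>d\<close> the power of \<open>q\<close> is 1 and the sign of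
  \<open>d * j\<close> is that of \<open>j\<close>. For even \<open>d\<close> that sign is trivial,
  but \<open>q ^ (d div 2) = -1\<close> restores it.\<close>

lemma reflection_weight_root_of_unity:
  fixes q :: "'a::field_char_0"
  assumes "d > 0" and qd: "q ^ d = 1" and prim: "\<And>i. 0 < i \<Longrightarrow> i < d \<Longrightarrow> q ^ i \<noteq> 1"
    and cop: "coprime d w"
  shows "reflection_weight w q (int d * j) = reflection_weight w 1 j"
proof (cases "even d")
  case True
  then obtain e where e: "d = 2 * e" by blast
  have "odd w"
    using cop True by (metis coprime_common_divisor odd_one)
  have "(q ^ e) ^ 2 = 1"
    using qd by (simp add: e power_mult mult.commute)
  moreover have "q ^ e \<noteq> 1"
    using \<open>d > 0\<close> e by (intro prim) auto
  ultimately have qe: "q ^ e = -1"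
    by (simp add: power2_eq_1_iff)
  have "int d * j * (int d * j + 1) = 2 * (int e * (j * (int d * j + 1)))"
    by (simp add: e)
  then have "int d * j * (int d * j + 1) div 2 = int e * (j * (int d * j + 1))"
    by (simp only: nonzero_mult_div_cancel_left)
  then have "int w * (int d * j * (int d * j + 1) div 2) = int e * (int w * j * (int d * j + 1))"
    by (simp only: mult_ac)
  then have "q powi (int w * (int d * j * (int d * j + 1) div 2))
      = (q ^ e) powi (int w * j * (int d * j + 1))"
    by (simp only: power_int_mult[of q "int e"] power_int_of_nat)
  \<comment> \<open>Both \<open>w\<close> and \<open>d * j + 1\<close> are odd, so the exponent has
    the parity of \<open>j\<close>.\<close>
  also have "\<dots> = (-1) powi j"
    using True \<open>odd w\<close> by (simp add: qe power_int_minus_left)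
  finally show ?thesis
    using True by (simp add: reflection_weight_def power_int_minus_left)
next
  case False
  have "even (j * (int d * j + 1))"
    using False by simp
  then obtain h where h: "j * (int d * j + 1) = 2 * h" by blast
  then have "int d * j * (int d * j + 1) = 2 * (int d * h)"
    by (simp add: mult.assoc)
  then have "int d * j * (int d * j + 1) div 2 = int d * h"
    by (simp only: nonzero_mult_div_cancel_left)
  then have "int w * (int d * j * (int d * j + 1) div 2) = int d * (int w * h)"
    by (simp only: mult_ac)
  then have "q powi (int w * (int d * j * (int d * j + 1) div 2)) = 1"
    by (simp only: power_int_mult[of q "int d"] power_int_of_nat qd power_int_1_left)
  then show ?thesis
    using False by (simp add: reflection_weight_def power_int_minus_left)
qed

text \<open>By q-Lucas, \<open>d\<close> must divide \<open>d * m + k * w\<close>, hence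
  \<open>k\<close>. The truncation \<open>d * M\<close> makes \<open>k = d * j\<close> run over
  exactly \<open>-M..M\<close> in \<open>j\<close>.\<close>

lemma reflection_sum_root_of_unity:
  fixes q :: "'a::field_char_0"
  assumes "d > 0" and qd: "q ^ d = 1" and prim: "\<And>i. 0 < i \<Longrightarrow> i < d \<Longrightarrow> q ^ i \<noteq> 1"
    and cop: "coprime d w"
  shows "reflection_sum (d * M) w q (2 * (d * m)) (int (d * m)) = reflection_sum M w 1 (2 * m) (int m)"
proof -
  define f where "f k = reflection_weight w q k
    * gauss_binomial q (2 * (d * m)) (int (d * m) + k * int w)" for k
  have N: "2 * (d * m) = d * (2 * m)" by simp
  note lucas = gauss_binomial_lucas[OF assms(1,2,3), of "2 * m", folded N]
  have zero: "f k = 0" if "\<not> int d dvd k" for k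
  proof -
    have "\<not> int d dvd int (d * m) + k * int w"
      using that cop by (simp add: dvd_add_right_iff coprime_dvd_mult_left_iff)
    then show ?thesis
      by (simp add: f_def lucas)
  qed
  have f: "f (int d * j) = reflection_weight w 1 j * gauss_binomial 1 (2 * m) (int m + j * int w)" for j
  proof -
    have "int (d * m) + int d * j * int w = int d * (int m + j * int w)"
      by (simp add: algebra_simps)
    then show ?thesis
      using \<open>d > 0\<close> by (simp add: f_def lucas reflection_weight_root_of_unity[OF assms])
  qed
  have "(\<Sum>k = - int (d * M)..int (d * M). f k) = (\<Sum>k\<in>(\<lambda>j. int d * j) ` {- int M..int M}. f k)"
  proof (rule sum.mono_neutral_right)
    show "(\<lambda>j. int d * j) ` {- int M..int M} \<subseteq> {- int (d * M)..int (d * M)}"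
    proof safe
      fix j assume "j \<in> {- int M..int M}"
      then have "int d * - int M \<le> int d * j" "int d * j \<le> int d * int M"
        by (intro mult_left_mono; simp)+
      then show "int d * j \<in> {- int (d * M)..int (d * M)}"
        by simp
    qed
    show "\<forall>k\<in>{- int (d * M)..int (d * M)} - (\<lambda>j. int d * j) ` {- int M..int M}. f k = 0"
    proof
      fix k assume k: "k \<in> {- int (d * M)..int (d * M)} - (\<lambda>j. int d * j) ` {- int M..int M}"
      have "\<not> int d dvd k"
      proof
        assume "int d dvd k"
        then obtain j where j: "k = int d * j" by blast
        with k have "int d * - int M \<le> int d * j" "int d * j \<le> int d * int M"
          by auto
        with \<open>d > 0\<close> have "j \<in> {- int M..int M}"
          by (simp only: mult_le_cancel_left_pos of_nat_0_less_iff atLeastAtMost_iff)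
        with j k show False by blast
      qed
      then show "f k = 0" by (rule zero)
    qed
  qed simp
  also have "\<dots> = (\<Sum>j = - int M..int M. f (int d * j))"
    using \<open>d > 0\<close> by (subst sum.reindex) (auto simp: inj_on_def)
  finally show ?thesis
    unfolding reflection_sum_def f_def[symmetric] f .
qed

lemma sum_maj_AVL_root_of_unity:
  fixes q :: "'a::field_char_0"
  assumes "d > 0" and qd: "q ^ d = 1" and prim: "\<And>i. 0 < i \<Longrightarrow> i < d \<Longrightarrow> q ^ i \<noteq> 1"
    and cop: "coprime d w" and w: "w > 0"
  shows "(\<Sum>b\<in>AVL (d * m) w. q ^ maj b) = of_nat (card (AVL m w))"
proof -
  have q: "q \<noteq> 0"
    using \<open>d > 0\<close> qd by (auto simp: power_0_left)
  \<comment> \<open>The truncation equals the word length here and becomes \<open>2 * m\<close>,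
    again the word length, at \<open>q = 1\<close>.\<close>
  have "(\<Sum>b\<in>AVL (d * m) w. q ^ maj b) = reflection_sum (d * (2 * m)) w q (2 * (d * m)) (int (d * m))"
    unfolding AVL_eq_walks walk_gf_def[symmetric] using w
    by (intro walk_gf_eq_reflection_sum[OF q w]) auto
  also have "\<dots> = reflection_sum (2 * m) w 1 (2 * m) (int m)"
    by (rule reflection_sum_root_of_unity[OF assms(1-4)])
  also have "\<dots> = walk_gf w 1 (2 * m) (int m)"
    using w by (intro walk_gf_eq_reflection_sum[symmetric]) auto
  finally show ?thesis
    by (simp add: walk_gf_1 AVL_eq_walks)
qed

section \<open>Fixed points of rotations\<close>

text \<open>\<open>rotate\<close> turns to the left, so a right shift by two is a rotation by
  \<open>length b - 2\<close>.\<close>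

lemma shift2_eq_rotate: "2 \<le> length b \<Longrightarrow> shift2 b = rotate (length b - 2) b"
  by (simp add: shift2_def rotate_drop_take)

lemma shift2_funpow:
  assumes "2 \<le> length b"
  shows "(shift2 ^^ k) b = rotate (k * (length b - 2)) b"
  using assms by (induction k) (simp_all add: shift2_eq_rotate rotate_rotate)

lemma rotate_mult_fixed: "rotate a y = y \<Longrightarrow> rotate (a * c) y = y"
  by (induction c) (simp_all add: rotate_rotate[symmetric])

text \<open>By Bezout, a multiple of \<open>a\<close> is congruent to the gcd modulo the
  length.\<close>

lemma rotate_fixed_gcd: "rotate a y = y \<longleftrightarrow> rotate (gcd a (length y)) y = y"
proof
  assume a: "rotate a y = y"
  obtain c where "[a * c = gcd a (length y)] (mod length y)"
    using cong_solve_nat by blast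
  then have "rotate (a * c) y = rotate (gcd a (length y)) y"
    by (metis cong_def rotate_conv_mod)
  with rotate_mult_fixed[OF a] show "rotate (gcd a (length y)) y = y"
    by simp
next
  assume "rotate (gcd a (length y)) y = y"
  then show "rotate a y = y"
    by (metis rotate_mult_fixed gcd_dvd1 dvd_def)
qed

text \<open>The total rotation is \<open>2 * k * (n - 1)\<close>, and \<open>n - 1\<close> is prime
  to \<open>n\<close>.\<close>

lemma shift2_funpow_fixed:
  assumes "length b = 2 * n" and "n \<ge> 1"
  shows "(shift2 ^^ k) b = b \<longleftrightarrow> rotate (2 * gcd k n) b = b"
proof -
  have "coprime (n - 1) n"
    using \<open>n \<ge> 1\<close> by (metis coprime_Suc_right_nat Suc_diff_1 less_le_trans zero_less_one)
  then have "gcd (k * (n - 1)) n = gcd k n"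
    by (simp add: gcd_mult_right_right_cancel coprime_commute gcd.commute)
  moreover have "k * (2 * n - 2) = 2 * (k * (n - 1))"
    by (simp add: algebra_simps)
  ultimately have "gcd (k * (2 * n - 2)) (2 * n) = 2 * gcd k n"
    by (metis gcd_mult_distrib_nat)
  then show ?thesis
    using assms shift2_funpow[of b k] rotate_fixed_gcd[of "k * (2 * n - 2)" b] by simp
qed

section \<open>Periodic words\<close>

lemma concat_replicate_commute: "concat (replicate e p) @ p = p @ concat (replicate e p)"
  by (induction e) simp_all

text \<open>Commutation makes \<open>p\<close> a prefix of the longer \<open>z\<close>; after
  cancelling it the rest still commutes with \<open>p\<close>.\<close>

lemma commute_imp_concat_replicate:
  assumes "p @ z = z @ p" and "length z = e * length p"
  shows "z = concat (replicate e p)"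
  using assms
proof (induction e arbitrary: z)
  case (Suc e)
  then have "length p \<le> length z" by simp
  with Suc.prems(1) obtain z' where z: "z = p @ z'"
    by (metis append_eq_append_conv_if append_take_drop_id)
  with Suc.prems have "z' = concat (replicate e p)"
    by (intro Suc.IH) auto
  with z show ?case by simp
qed simp

lemma rotate_fixed_iff_concat_replicate:
  assumes "d > 0" and "length y = d * L"
  shows "rotate L y = y \<longleftrightarrow> y = concat (replicate d (take L y))"
proof -
  obtain e where e: "d = Suc e"
    using \<open>d > 0\<close> gr0_implies_Suc by blast
  define p z where "p = take L y" and "z = drop L y"
  have y: "y = p @ z" and p: "length p = L" and z: "length z = e * length p"
    using assms by (simp_all add: p_def z_def e)
  have "rotate L y = z @ p"
    using rotate_append[of p z] p y by simp
  moreover have "p @ z = z @ p \<longleftrightarrow> z = concat (replicate e p)"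
    using commute_imp_concat_replicate[OF _ z] concat_replicate_commute[of e p] by metis
  moreover have "y = concat (replicate d p) \<longleftrightarrow> z = concat (replicate e p)"
    by (simp add: y e)
  ultimately show ?thesis
    unfolding p_def[symmetric] using y by metis
qed

lemma count_list_concat_replicate:
  "count_list (concat (replicate d p)) a = d * count_list p a"
  by (induction d) simp_all

text \<open>Each copy of \<open>p\<close> starts and ends on the diagonal, so it visits the same
  heights.\<close>

lemma avoids_concat_replicate:
  assumes "height p = 0" and "d > 0"
  shows "avoids w (concat (replicate d p)) \<longleftrightarrow> avoids w p"
  using \<open>d > 0\<close>
proof (induction d rule: nat_induct_non_zero)
  case (Suc d)
  have "avoids w (p @ concat (replicate d p)) \<longleftrightarrow> avoids w p \<and> avoids w (concat (replicate d p))"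
    by (simp add: avoids_append assms(1)) (simp add: avoids_def)
  with Suc show ?case by simp
qed simp

lemma fixed_AVL_eq_image:
  assumes "d > 0"
  shows "{y \<in> AVL (d * m) w. rotate (2 * m) y = y} = (\<lambda>p. concat (replicate d p)) ` AVL m w"
    (is "?L = ?R")
proof -
  \<comment> \<open>Having \<open>d * m\<close> zeros in the repetition means \<open>m\<close> zeros
    in \<open>p\<close>, so \<open>p\<close> returns to the diagonal.\<close>
  have key: "concat (replicate d p) \<in> AVL (d * m) w \<longleftrightarrow> p \<in> AVL m w" if "length p = 2 * m" for p
  proof -
    have "length (concat (replicate d p)) = d * (2 * m)"
      using that by (simp add: length_concat sum_list_replicate)
    moreover have "height p = 0" if "set p \<subseteq> {0, 1}" "count_list p 0 = m"
      using that length_binary[of p] \<open>length p = 2 * m\<close> by (simp add: height_def)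
    ultimately show ?thesis
      using assms that
      by (auto simp: AVL_eq_walks walks_def count_list_concat_replicate avoids_concat_replicate)
  qed
  show ?thesis
  proof
    show "?L \<subseteq> ?R"
    proof
      fix y assume y: "y \<in> ?L"
      then have len: "length y = d * (2 * m)"
        by (simp add: AVL_eq_walks walks_def)
      define p where "p = take (2 * m) y"
      have "y = concat (replicate d p)"
        using y rotate_fixed_iff_concat_replicate[OF assms len] by (simp add: p_def)
      moreover have "length p = 2 * m"
        using len assms by (simp add: p_def)
      ultimately show "y \<in> ?R"
        using key[of p] y by blast
    qed
    show "?R \<subseteq> ?L"
    proof
      fix y assume "y \<in> ?R"
      then obtain p where p: "p \<in> AVL m w" and y: "y = concat (replicate d p)" by blast
      have lp: "length p = 2 * m"
        using p by (simp add: AVL_eq_walks walks_def)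
      with key p y have yA: "y \<in> AVL (d * m) w" by simp
      then have len: "length y = d * (2 * m)"
        by (simp add: AVL_eq_walks walks_def)
      have "take (2 * m) y = p"
        using assms lp by (cases d) (simp_all add: y)
      then have "rotate (2 * m) y = y"
        using rotate_fixed_iff_concat_replicate[OF assms len] y by simp
      with yA show "y \<in> ?L" by simp
    qed
  qed
qed

lemma card_fixed_AVL:
  assumes "d > 0"
  shows "card {y \<in> AVL (d * m) w. rotate (2 * m) y = y} = card (AVL m w)"
proof -
  have "take (2 * m) (concat (replicate d p)) = p" if "p \<in> AVL m w" for p
    using assms that by (cases d) (simp_all add: AVL_eq_walks walks_def)
  then have "inj_on (\<lambda>p. concat (replicate d p)) (AVL m w)"
    by (rule inj_on_inverseI)
  then show ?thesis
    by (simp add: fixed_AVL_eq_image[OF assms] card_image)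
qed

section \<open>Subset cyclic sieving\<close>

lemma finite_balanced_words: "finite (balanced_words n)"
  by (rule finite_subset[OF _ finite_lists_length_eq[of "{0, 1}" "2 * n"]])
    (auto simp: balanced_words_def)

lemma count_list_rotate: "count_list (rotate k b) a = count_list b a"
proof -
  have "count_list (rotate1 c) a = count_list c a" for c
    by (cases c) auto
  then show ?thesis
    by (induction k) simp_all
qed

lemma bij_betw_shift2:
  assumes "n \<ge> 1"
  shows "bij_betw shift2 (balanced_words n) (balanced_words n)"
proof -
  have eq: "shift2 b = rotate (2 * n - 2) b" if "b \<in> balanced_words n" for b
    using that assms shift2_eq_rotate[of b] by (simp add: balanced_words_def)
  have len: "2 + (2 * n - 2) = 2 * n"
    using assms by simp
  \<comment> \<open>A further rotation by 2 completes the full turn and undoes the shift.\<close>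
  have "inj_on shift2 (balanced_words n)"
  proof (rule inj_onI)
    fix b c assume b: "b \<in> balanced_words n" and c: "c \<in> balanced_words n" and "shift2 b = shift2 c"
    then have "rotate 2 (rotate (2 * n - 2) b) = rotate 2 (rotate (2 * n - 2) c)"
      by (simp add: eq)
    then have "rotate (2 * n) b = rotate (2 * n) c"
      by (simp only: rotate_rotate len)
    then show "b = c"
      using b c by (simp add: balanced_words_def rotate_id)
  qed
  moreover have "shift2 ` balanced_words n \<subseteq> balanced_words n"
    by (auto simp: eq) (auto simp: balanced_words_def count_list_rotate)
  ultimately show ?thesis
    by (simp add: bij_betw_def endo_inj_surj finite_balanced_words)
qed

lemma shift2_order:
  assumes "n \<ge> 1"
  shows "(\<forall>x\<in>balanced_words n. (shift2 ^^ k) x = x) \<longleftrightarrow> n dvd k"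
proof
  assume fixed: "\<forall>x\<in>balanced_words n. (shift2 ^^ k) x = x"
  \<comment> \<open>A word whose only rotational symmetries are full turns.\<close>
  define b :: "nat list" where "b = replicate n 1 @ replicate n 0"
  define m where "m = gcd k n"
  have count: "count_list (replicate i x) y = (if x = y then i else 0)" for i and x y :: nat
    by (induction i) auto
  have "b \<in> balanced_words n"
    by (auto simp: b_def balanced_words_def count)
  with fixed have rot: "rotate (2 * m) b = b"
    using shift2_funpow_fixed[of b n k] assms by (simp add: b_def m_def)
  have "m > 0" "m dvd n"
    using assms by (simp_all add: m_def)
  have "m = n"
  proof (rule ccontr)
    assume "m \<noteq> n"
    obtain c where c: "n = m * c" using \<open>m dvd n\<close> by blast
    with \<open>m \<noteq> n\<close> assms have "c \<ge> 2"
      by (cases c; cases "c - 1") auto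
    then have "m * 2 \<le> m * c"
      by (rule mult_le_mono2)
    then have le: "2 * m \<le> n"
      using c by simp
    \<comment> \<open>Position \<open>n - 1\<close> holds the last 1; since
      \<open>0 < 2 * m \<le> n\<close>, moving on by \<open>2 * m\<close> lands among the
      zeros.\<close>
    have "rotate (2 * m) b ! (n - 1) = b ! ((2 * m + (n - 1)) mod (2 * n))"
      using assms by (subst nth_rotate) (simp_all add: b_def mult_2)
    also have "(2 * m + (n - 1)) mod (2 * n) = 2 * m + (n - 1)"
      using le assms by simp
    also have "b ! \<dots> = 0"
      using le assms \<open>m > 0\<close> by (simp add: b_def nth_append)
    finally show False
      using rot assms by (simp add: b_def nth_append)
  qed
  then show "n dvd k"
    by (metis m_def gcd_dvd1)
next
  assume "n dvd k"
  then have "gcd k n = n"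
    by (simp add: gcd_proj2_iff)
  show "\<forall>x\<in>balanced_words n. (shift2 ^^ k) x = x"
  proof
    fix x assume "x \<in> balanced_words n"
    then have "length x = 2 * n" by (simp add: balanced_words_def)
    then show "(shift2 ^^ k) x = x"
      using shift2_funpow_fixed[of x n k] assms \<open>gcd k n = n\<close> by (simp add: rotate_id)
  qed
qed

lemma root_of_unity_power_eq_1_iff:
  assumes "n \<ge> 1"
  shows "exp (2 * of_real pi * \<i> / of_nat n) ^ j = (1 :: complex) \<longleftrightarrow> n dvd j"
proof -
  have "exp (2 * of_real pi * \<i> / of_nat n) ^ j = exp (2 * of_real pi * \<i> * of_nat j / of_nat n)"
    by (simp add: mult_ac flip: exp_of_nat_mult)
  then show ?thesis
    using complex_root_unity_eq_1[OF assms, of j] by simp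
qed

theorem theorem5p5:
  fixes n w :: nat
  assumes "n \<ge> 1" and "w \<ge> 1" and "gcd n w = 1"
  shows "subset_csp (balanced_words n) (AVL n w) shift2 n (maj_poly (AVL n w))"
proof -
  have "poly (map_poly of_nat (maj_poly (AVL n w))) (exp (2 * of_real pi * \<i> / of_nat n) ^ k)
      = (of_nat (card {y \<in> AVL n w. (shift2 ^^ k) y = y}) :: complex)" for k
  proof -
    \<comment> \<open>\<open>z\<close> turns out to have exact order \<open>d\<close>, and a word of
      length \<open>2 * n\<close> is fixed by the \<open>k\<close>-th power of the shift iff it is
      fixed by rotation by \<open>2 * m\<close>.\<close>
    define m where "m = gcd k n"
    define d where "d = n div m"
    define z where "z = exp (2 * of_real pi * \<i> / of_nat n) ^ k"
    have n: "n = d * m"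
      by (simp add: d_def m_def)
    have "m > 0"
      using \<open>n \<ge> 1\<close> by (simp add: m_def)
    have "d > 0"
      using \<open>n \<ge> 1\<close> n by (cases d) auto
    have order: "z ^ i = 1 \<longleftrightarrow> d dvd i" for i
    proof -
      have "z ^ i = 1 \<longleftrightarrow> n dvd k * i"
        using root_of_unity_power_eq_1_iff[OF \<open>n \<ge> 1\<close>, of "k * i"] by (simp add: z_def power_mult)
      also have "k * i = k div m * i * m"
        by (simp add: m_def)
      also have "n dvd k div m * i * m \<longleftrightarrow> d dvd k div m * i"
        unfolding n using \<open>m > 0\<close> by simp
      also have "\<dots> \<longleftrightarrow> d dvd i"
      proof (rule coprime_dvd_mult_right_iff)
        show "coprime d (k div m)"
          unfolding d_def m_def using \<open>n \<ge> 1\<close>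
          by (subst coprime_commute, intro div_gcd_coprime) auto
      qed
      finally show ?thesis .
    qed
    have "coprime d w"
      using \<open>gcd n w = 1\<close> n by (metis coprime_iff_gcd_eq_1 coprime_mult_left_iff)
    have "poly (map_poly of_nat (maj_poly (AVL n w))) z = (\<Sum>b\<in>AVL n w. z ^ maj b)"
      by (rule poly_maj_poly) (simp add: AVL_eq_walks finite_walks)
    also have "\<dots> = of_nat (card (AVL m w))"
      unfolding n using \<open>d > 0\<close> \<open>coprime d w\<close> \<open>w \<ge> 1\<close>
      by (intro sum_maj_AVL_root_of_unity) (auto simp: order dest: dvd_imp_le)
    also have "card (AVL m w) = card {y \<in> AVL n w. rotate (2 * m) y = y}"
      using card_fixed_AVL[OF \<open>d > 0\<close>, of m w] n by simp
    also have "{y \<in> AVL n w. rotate (2 * m) y = y} = {y \<in> AVL n w. (shift2 ^^ k) y = y}"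
      using \<open>n \<ge> 1\<close> by (auto simp: AVL_eq_walks walks_def shift2_funpow_fixed m_def)
    finally show ?thesis
      by (simp add: z_def)
  qed
  then show ?thesis
    using assms(1) finite_balanced_words[of n] bij_betw_shift2[of n] shift2_order[of n]
    unfolding subset_csp_def by (auto simp: AVL_def)
qed

end
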